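(* Let $n\ge1$ and let $\mathcal{A}\subset\mathbb{Z}_{\ge0}^n$ be a finite subset such that $\{0,v_1,\ldots,v_n\}\subset\mathcal{A}$, where $v_i=(0,\ldots,d_{\mathcal{A}},\ldots,0)$ with $d_{\mathcal{A}}$ in position $i$. Let $r(\mathcal{A})$ be the reduction number. Then: (i) if $r(\mathcal{A})\le1$, then $n_0(\mathcal{A})\le2$; (ii) if $r(\mathcal{A})>1$, then $$n_0(\mathcal{A})\le\min\left\{(n+1)(r(\mathcal{A})-1)-n+2,\ (n+1)r(\mathcal{A})-\left\lceil\frac{(n+1)r(\mathcal{A})}{d_{\mathcal{A}}}\right\rceil+1\right\}.$$
   Context: For $t\ge1$ and a finite subset $\mathcal{B}$ of $\mathbb{Z}^m$, $t\mathcal{B}=\{b_1+\cdots+b_t\mid b_i\in\mathcal{B}\}$ (repetitions allowed), $0\mathcal{B}=\{0\}$. Put $\varphi_{\mathcal{A}}(t)=|t\mathcal{A}|$. There is a polynomial $p_{\mathcal{A}}\in\mathbb{Q}[t]$ with $\varphi_{\mathcal{A}}(t)=p_{\mathcal{A}}(t)$ for $t\gg0$ (Khovanskii), and the phase transition is $n_0(\mathcal{A})=\min\{n_0\in\mathbb{Z}_{\ge0}\mid\varphi_{\mathcal{A}}(t)=p_{\mathcal{A}}(t)\ \forall t\ge n_0\}$. For $a\in\mathcal{A}$ put $|a|=a_1+\cdots+a_n$, and let $d_{\mathcal{A}}$ be the least integer $\delta\ge0$ with $|a|\le\delta$ for all $a\in\mathcal{A}$; here $d_{\mathcal{A}}\ge1$,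 so that the convex hull of $\mathcal{A}$ is the $n$-simplex with vertices $0,v_1,\ldots,v_n$. Put $\overline{\mathcal{A}}=\{(d_{\mathcal{A}}-|a|,a_1,\ldots,a_n)\mid a\in\mathcal{A}\}\subset\mathbb{Z}_{\ge0}^{n+1}$ and let $e_0=(d_{\mathcal{A}},0,\ldots,0),\ldots,e_n=(0,\ldots,0,d_{\mathcal{A}})\in\overline{\mathcal{A}}$. The reduction number $r(\mathcal{A})$ (of the semigroup ring generated by the monomials with exponents in $\overline{\mathcal{A}}$) is the least positive integer $r$ such that $(r+1)\overline{\mathcal{A}}=\{e_0,\ldots,e_n\}+r\overline{\mathcal{A}}$, where the right-hand side is the Minkowski sum. *)

theory Defs
  imports
    Complex_Main
    "HOL-Library.Function_Algebras"
    "HOL-Library.Set_Algebras"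
    "HOL-Computational_Algebra.Polynomial"
begin

text \<open>
  A vector of \<open>\<int>\<^sup>n\<close> is a function \<open>nat \<Rightarrow> int\<close> supported on the coordinates \<open>1, \<dots>, n\<close>, and a vector
  of \<open>\<int>\<^sup>n\<^sup>+\<^sup>1\<close> one supported on \<open>0, \<dots>, n\<close>, so that coordinate \<open>0\<close> is the homogenizing one. Addition
  of vectors is pointwise (\<open>Function_Algebras\<close>), and \<open>+\<close> on sets is the Minkowski sum
  (\<open>Set_Algebras\<close>).
\<close>

definition nonneg_vectors :: "nat \<Rightarrow> (nat \<Rightarrow> int) set" where
  "nonneg_vectors n = {a. (\<forall>i. 0 \<le> a i) \<and> (\<forall>i. i \<notin> {1..n} \<longrightarrow> a i = 0)}"

definition nfold_sumset :: "nat \<Rightarrow> 'a::comm_monoid_add set \<Rightarrow> 'a set" where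
  "nfold_sumset t B = {\<Sum>i<t. b i | b. \<forall>i<t. b i \<in> B}"

text \<open>
  The polynomial that agrees with \<open>t \<mapsto> |tA|\<close> for all large \<open>t\<close>. It exists for every finite \<open>A\<close> by
  Khovanskii's theorem, and two polynomials with infinitely many common values are equal.
\<close>

definition khovanskii_poly :: "'a::comm_monoid_add set \<Rightarrow> rat poly" where
  "khovanskii_poly A =
     (THE p. \<forall>\<^sub>F t in sequentially. of_nat (card (nfold_sumset t A)) = poly p (of_nat t))"

definition phase_transition :: "'a::comm_monoid_add set \<Rightarrow> nat" where
  "phase_transition A =
     (LEAST n0. \<forall>t\<ge>n0. of_nat (card (nfold_sumset t A)) = poly (khovanskii_poly A) (of_nat t))"

definition total_degree :: "nat \<Rightarrow> (nat \<Rightarrow> int) \<Rightarrow> int" where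
  "total_degree n a = (\<Sum>i=1..n. a i)"

definition max_degree :: "nat \<Rightarrow> (nat \<Rightarrow> int) set \<Rightarrow> nat" where
  "max_degree n A = (LEAST \<delta>. \<forall>a\<in>A. total_degree n a \<le> int \<delta>)"

text \<open>The vertices \<open>v\<^sub>i\<close> (for \<open>1 \<le> i \<le> n\<close>) and \<open>e\<^sub>i\<close> (for \<open>0 \<le> i \<le> n\<close>), with \<open>d\<close> in coordinate \<open>i\<close>.\<close>

definition axis_vector :: "nat \<Rightarrow> nat \<Rightarrow> (nat \<Rightarrow> int)" where
  "axis_vector d i = (\<lambda>j. if j = i then int d else 0)"

definition homogenization :: "nat \<Rightarrow> (nat \<Rightarrow> int) set \<Rightarrow> (nat \<Rightarrow> int) set" where
  "homogenization n A = (\<lambda>a. a(0 := int (max_degree n A) - total_degree n a)) ` A"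

definition reduction_number :: "nat \<Rightarrow> (nat \<Rightarrow> int) set \<Rightarrow> nat" where
  "reduction_number n A =
     (LEAST r. 0 < r \<and>
        nfold_sumset (r + 1) (homogenization n A) =
          axis_vector (max_degree n A) ` {0..n} + nfold_sumset r (homogenization n A))"

end

theory Submission imports Defs "HOL-Library.FuncSet" begin

text \<open>
  Write \<open>B\<close> for the homogenization of \<open>A\<close>, \<open>d\<close> for the maximal degree, \<open>r\<close> for the reduction number
  and \<open>E\<close> for the set of vertices \<open>e\<^sub>0, \<dots>, e\<^sub>n\<close>. Forgetting coordinate \<open>0\<close> maps \<open>tB\<close> bijectively
  onto \<open>tA\<close>, so it suffices to count \<open>tB\<close>, a set of lattice points with coordinate sum \<open>t d\<close>.

  By the choice of \<open>r\<close>, every element of \<open>tB\<close> is a sum of at most \<open>r\<close> non-vertices plus vertices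
  (\<open>nfold_sumset_decomposition\<close>). In algebraic terms, the semigroup ring of \<open>B\<close> is generated as a
  module over the polynomial ring on \<open>E\<close> by the finite set \<open>G\<close> of sums of at most \<open>r\<close> non-vertices.
  Hence \<open>tB\<close> is the level \<open>t\<close> of the union of the cones \<open>b + d \<nat>\<^sup>n\<^sup>+\<^sup>1\<close>, \<open>b \<in> G\<close>
  (\<open>nfold_sumset_eq_Union_cones\<close>).

  Two such cones are disjoint if their apexes differ modulo \<open>d\<close>; otherwise they meet in the cone
  whose apex is the coordinatewise maximum. By inclusion-exclusion \<open>|tB|\<close> is a signed sum of the
  counting functions of single cones whose apexes are such maxima. Each coordinate of such an apex
  is that of a generator congruent to it; the points with this property are here called corners. A
  cone with apex of coordinate sum \<open>d D\<close> has \<open>(t - D + n) choose n\<close> points at level \<open>t\<close>. This is a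
  polynomial in \<open>t\<close> for \<open>t \<ge> D - n\<close>, and not only for \<open>t \<ge> D\<close>, because the binomial polynomial
  vanishes at the integers from \<open>D - n\<close> to \<open>D - 1\<close>. So the phase transition is at most
  \<open>max 0 (D - n)\<close> for the largest level \<open>D\<close> of a corner
  (\<open>polynomial_from_card_nfold_sumset\<close>).

  Two estimates of \<open>D\<close> give the two terms of the minimum. A coordinate of a non-vertex is at most
  \<open>d - 1\<close>, so the coordinates of a corner are at most \<open>r (d - 1)\<close> (\<open>corner_level_le_coord\<close>).
  Moreover, the generators that provide the coordinates of a corner have the same residues modulo
  \<open>d\<close>; if one of them has a coordinate with a large quotient by \<open>d\<close>, then the bound \<open>r d\<close> on its coordinate sum leaves little
  room for the residues, which gives \<open>D \<le> n (r - 1) + r\<close> (\<open>corner_level_le_residue\<close>).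
\<close>

section \<open>Minkowski powers\<close>

lemma nfold_sumset_0: "nfold_sumset 0 B = {0}"
  by (auto simp: nfold_sumset_def)

lemma nfold_sumset_Suc: "nfold_sumset (Suc t) B = B + nfold_sumset t B"
proof (intro equalityI subsetI)
  fix x assume "x \<in> nfold_sumset (Suc t) B"
  then obtain b where b: "x = (\<Sum>i<Suc t. b i)" "\<forall>i<Suc t. b i \<in> B"
    by (auto simp: nfold_sumset_def)
  then have "(\<Sum>i<t. b i) \<in> nfold_sumset t B"
    by (auto simp: nfold_sumset_def)
  with b have "b t + (\<Sum>i<t. b i) \<in> B + nfold_sumset t B"
    by (intro set_plus_intro) auto
  with b show "x \<in> B + nfold_sumset t B"
    by (simp add: add.commute)
next
  fix x assume "x \<in> B + nfold_sumset t B"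
  then obtain a b where "a \<in> B" "x = a + (\<Sum>i<t. b i)" "\<forall>i<t. b i \<in> B"
    by (auto simp: nfold_sumset_def set_plus_def)
  then show "x \<in> nfold_sumset (Suc t) B"
    by (auto simp: nfold_sumset_def add.commute less_Suc_eq intro!: exI[of _ "b(t := a)"])
qed

lemma finite_nfold_sumset: "finite B \<Longrightarrow> finite (nfold_sumset t B)"
  by (induction t) (auto simp: nfold_sumset_0 nfold_sumset_Suc intro: finite_set_plus)

lemma nfold_sumset_mono: "B \<subseteq> C \<Longrightarrow> nfold_sumset t B \<subseteq> nfold_sumset t C"
  by (fastforce simp: nfold_sumset_def)

lemma nfold_sumset_add:
  "nfold_sumset s B + nfold_sumset t B = nfold_sumset (s + t) B"
  by (induction s) (simp_all add: nfold_sumset_0 nfold_sumset_Suc add.assoc)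

lemma nfold_sumset_image:
  assumes "f 0 = 0" and "\<And>x y. f (x + y) = f x + f y"
  shows "nfold_sumset t (f ` B) = f ` nfold_sumset t B"
proof (induction t)
  case 0
  then show ?case using assms by (simp add: nfold_sumset_0)
next
  case (Suc t)
  have "f ` B + f ` C = f ` (B + C)" for C
    by (auto simp: set_plus_def assms(2)[symmetric])
  with Suc show ?case by (simp add: nfold_sumset_Suc)
qed

lemma sum_in_nfold_sumset:
  assumes "finite I" and "\<And>i. i \<in> I \<Longrightarrow> b i \<in> B"
  shows "sum b I \<in> nfold_sumset (card I) B"
  using assms
  by (induction I) (auto simp: nfold_sumset_0 nfold_sumset_Suc intro: set_plus_intro)

section \<open>Eventually polynomial counting functions\<close>

definition polynomial_from :: "nat \<Rightarrow> (nat \<Rightarrow> rat) \<Rightarrow> bool" where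
  "polynomial_from T f \<longleftrightarrow> (\<exists>p. \<forall>t\<ge>T. f t = poly p (of_nat t))"

lemma polynomial_from_0: "polynomial_from T (\<lambda>t. 0)"
  unfolding polynomial_from_def by (rule exI[of _ 0]) simp

lemma polynomial_from_add:
  "polynomial_from T f \<Longrightarrow> polynomial_from T g \<Longrightarrow> polynomial_from T (\<lambda>t. f t + g t)"
  unfolding polynomial_from_def by (metis poly_add)

lemma polynomial_from_diff:
  "polynomial_from T f \<Longrightarrow> polynomial_from T g \<Longrightarrow> polynomial_from T (\<lambda>t. f t - g t)"
  unfolding polynomial_from_def by (metis poly_diff)

text \<open>
  Inclusion-exclusion for families indexed by \<open>t\<close>. Closure of \<open>\<C>\<close> under intersection allows
  induction on the number of families: the intersections of one member with the others are again
  members of \<open>\<C>\<close>, and fewer of them.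
\<close>

lemma card_Union_polynomial_from:
  fixes \<C> :: "(nat \<Rightarrow> 'a set) set"
  assumes "finite F" and "F \<subseteq> \<C>"
    and closed: "\<And>c c'. c \<in> \<C> \<Longrightarrow> c' \<in> \<C> \<Longrightarrow> (\<lambda>t. c t \<inter> c' t) \<in> \<C>"
    and fin: "\<And>c t. c \<in> \<C> \<Longrightarrow> finite (c t)"
    and poly: "\<And>c. c \<in> \<C> \<Longrightarrow> polynomial_from T (\<lambda>t. of_nat (card (c t)))"
  shows "polynomial_from T (\<lambda>t. of_nat (card (\<Union>c\<in>F. c t)))"
  using assms(1,2)
proof (induction "card F" arbitrary: F rule: less_induct)
  case less
  show ?case
  proof (cases "F = {}")
    case True
    then show ?thesis by (simp add: polynomial_from_0)
  next
    case False
    then obtain c where c: "c \<in> F" by blast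
    define F1 where "F1 = F - {c}"
    \<comment> \<open>\<open>F2\<close> may have fewer members than \<open>F1\<close>, since different intersections can coincide.\<close>
    define F2 where "F2 = (\<lambda>c' t. c t \<inter> c' t) ` F1"
    have cC: "c \<in> \<C>" using c less.prems by blast
    have F1: "finite F1" "F1 \<subseteq> \<C>" "card F1 < card F"
      using less.prems c card_Diff1_less[of F c] by (auto simp: F1_def simp del: card_Diff_insert)
    have F2: "finite F2" "F2 \<subseteq> \<C>" "card F2 < card F"
      using F1 cC closed card_image_le[of F1 "\<lambda>c' t. c t \<inter> c' t"] by (auto simp: F2_def)
    have eq: "(of_nat (card (\<Union>c\<in>F. c t)) :: rat) =
        of_nat (card (c t)) + of_nat (card (\<Union>c\<in>F1. c t)) - of_nat (card (\<Union>c\<in>F2. c t))" for t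
    proof -
      have "(\<Union>c\<in>F. c t) = c t \<union> (\<Union>c\<in>F1. c t)"
        using c by (auto simp: F1_def)
      moreover have "(\<Union>c\<in>F2. c t) = c t \<inter> (\<Union>c\<in>F1. c t)"
        by (auto simp: F2_def)
      moreover have "finite (c t)" "finite (\<Union>c\<in>F1. c t)"
        using F1 cC fin by auto
      ultimately have "card (c t) + card (\<Union>c\<in>F1. c t) =
          card (\<Union>c\<in>F. c t) + card (\<Union>c\<in>F2. c t)"
        using card_Un_Int[of "c t" "\<Union>c\<in>F1. c t"] by simp
      then have "(of_nat (card (c t) + card (\<Union>c\<in>F1. c t)) :: rat) =
          of_nat (card (\<Union>c\<in>F. c t) + card (\<Union>c\<in>F2. c t))"
        by (rule arg_cong)
      then show ?thesis by simp
    qed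
    show ?thesis unfolding eq
      by (intro polynomial_from_add polynomial_from_diff poly cC less.hyps F1 F2)
  qed
qed

lemma poly_eq_if_eventually_eq:
  fixes p q :: "rat poly"
  assumes "\<forall>\<^sub>F t in sequentially. poly p (of_nat t) = poly q (of_nat t)"
  shows "p = q"
proof (rule ccontr)
  assume "p \<noteq> q"
  then have "finite {x. poly (p - q) x = 0}"
    by (intro poly_roots_finite) simp
  moreover obtain N where "\<And>t. t \<ge> N \<Longrightarrow> poly p (of_nat t) = poly q (of_nat t)"
    using assms unfolding eventually_sequentially by blast
  then have "of_nat ` {N..} \<subseteq> {x. poly (p - q) x = 0}"
    by auto
  ultimately have "finite ((of_nat :: nat \<Rightarrow> rat) ` {N..})"
    by (rule rev_finite_subset)
  then have "finite {N..}"
    by (rule finite_imageD) (simp add: inj_on_def)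
  then show False using infinite_Ici by blast
qed

text \<open>
  A polynomial that counts \<open>tA\<close> from \<open>T\<close> on is the Khovanskii polynomial, since two polynomials that
  agree at infinitely many points are equal.
\<close>

lemma phase_transition_le:
  assumes "polynomial_from T (\<lambda>t. of_nat (card (nfold_sumset t A)))"
  shows "phase_transition A \<le> T"
proof -
  obtain p :: "rat poly"
    where p: "\<And>t. t \<ge> T \<Longrightarrow> of_nat (card (nfold_sumset t A)) = poly p (of_nat t)"
    using assms unfolding polynomial_from_def by blast
  have "khovanskii_poly A = p"
    unfolding khovanskii_poly_def
  proof (rule the_equality)
    show ev: "\<forall>\<^sub>F t in sequentially. of_nat (card (nfold_sumset t A)) = poly p (of_nat t)"
      unfolding eventually_sequentially using p by blast
    fix q :: "rat poly"
    assume "\<forall>\<^sub>F t in sequentially. of_nat (card (nfold_sumset t A)) = poly q (of_nat t)"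
    with ev have "\<forall>\<^sub>F t in sequentially. poly q (of_nat t) = poly p (of_nat t)"
      by eventually_elim simp
    then show "q = p" by (rule poly_eq_if_eventually_eq)
  qed
  then show ?thesis
    unfolding phase_transition_def by (intro Least_le) (use p in auto)
qed

section \<open>Dilated simplices and lattice cones\<close>

text \<open>
  The lattice points of \<open>t\<close> times the simplex with vertices \<open>e\<^sub>0, \<dots>, e\<^sub>n\<close>.
\<close>

definition dilated_simplex :: "nat \<Rightarrow> nat \<Rightarrow> nat \<Rightarrow> (nat \<Rightarrow> int) set" where
  "dilated_simplex n d t =
     {x. (\<forall>i. 0 \<le> x i) \<and> (\<forall>i>n. x i = 0) \<and> (\<Sum>i\<le>n. x i) = int (d * t)}"

text \<open>
  The part of \<open>z + d \<nat>\<^sup>n\<^sup>+\<^sup>1\<close> at level \<open>t\<close>. The argument \<open>t\<close> comes last, so that a cone is a family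
  of finite sets indexed by the level.
\<close>

definition lattice_cone :: "nat \<Rightarrow> nat \<Rightarrow> (nat \<Rightarrow> int) \<Rightarrow> nat \<Rightarrow> (nat \<Rightarrow> int) set" where
  "lattice_cone n d z t = {x \<in> dilated_simplex n d t. \<forall>i. z i \<le> x i \<and> int d dvd x i - z i}"

lemma lattice_cone_level_le:
  assumes d: "d \<ge> 1" and z: "z \<in> dilated_simplex n d D" and x: "x \<in> lattice_cone n d z t"
  shows "D \<le> t"
proof -
  have "(\<Sum>i\<le>n. z i) \<le> (\<Sum>i\<le>n. x i)"
    using x by (intro sum_mono) (auto simp: lattice_cone_def)
  then have "d * D \<le> d * t"
    using x z by (simp add: lattice_cone_def dilated_simplex_def flip: of_nat_mult)
  then show ?thesis using d by simp
qed

text \<open>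
  Dividing \<open>x - z\<close> by \<open>d\<close> turns the points of the cone into the compositions of \<open>t - D\<close> into \<open>n + 1\<close>
  nonnegative parts.
\<close>

lemma card_lattice_cone:
  assumes d: "d \<ge> 1" and z: "z \<in> dilated_simplex n d D"
  shows "card (lattice_cone n d z t) = (if D \<le> t then (t - D + n) choose n else 0)"
proof (cases "D \<le> t")
  case False
  then have "lattice_cone n d z t = {}"
    using lattice_cone_level_le[OF d z] by blast
  with False show ?thesis by simp
next
  case True
  define L where "L = {l :: nat list. length l = Suc n \<and> sum_list l = t - D}"
  define \<phi> where "\<phi> l = (\<lambda>i. if i \<le> n then z i + int d * int (l ! i) else 0)" for l
  define \<psi> where "\<psi> x = map (\<lambda>i. nat ((x i - z i) div int d)) [0..<Suc n]" for x
  have zs: "\<And>i. 0 \<le> z i" "\<And>i. i > n \<Longrightarrow> z i = 0" "(\<Sum>i\<le>n. z i) = int (d * D)"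
    using z by (auto simp: dilated_simplex_def)
  have "bij_betw \<phi> L (lattice_cone n d z t)"
  proof (rule bij_betw_byWitness[where f' = \<psi>])
    show "\<forall>l\<in>L. \<psi> (\<phi> l) = l"
    proof
      fix l assume "l \<in> L"
      then have "length l = Suc n" by (simp add: L_def)
      then show "\<psi> (\<phi> l) = l"
        unfolding \<psi>_def using d by (intro nth_equalityI) (auto simp: \<phi>_def simp del: upt_Suc)
    qed
    show "\<forall>x\<in>lattice_cone n d z t. \<phi> (\<psi> x) = x"
    proof
      fix x assume x: "x \<in> lattice_cone n d z t"
      show "\<phi> (\<psi> x) = x"
      proof
        fix i
        have "z i \<le> x i" "int d dvd x i - z i"
          using x by (auto simp: lattice_cone_def)
        moreover have "x i = 0" if "i > n"
          using x that by (auto simp: lattice_cone_def dilated_simplex_def)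
        ultimately show "\<phi> (\<psi> x) i = x i"
          using d by (auto simp: \<phi>_def \<psi>_def pos_imp_zdiv_nonneg_iff simp del: upt_Suc)
      qed
    qed
    show "\<phi> ` L \<subseteq> lattice_cone n d z t"
    proof
      fix x assume "x \<in> \<phi> ` L"
      then obtain l where l: "length l = Suc n" "sum_list l = t - D" and x: "x = \<phi> l"
        by (auto simp: L_def)
      have "(\<Sum>i\<le>n. l ! i) = t - D"
        using l by (simp add: sum_list_sum_nth atLeast0LessThan lessThan_Suc_atMost)
      moreover have "(\<Sum>i\<le>n. x i) = (\<Sum>i\<le>n. z i) + int d * int (\<Sum>i\<le>n. l ! i)"
        by (simp add: x \<phi>_def sum.distrib sum_distrib_left)
      ultimately have "(\<Sum>i\<le>n. x i) = int (d * t)"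
        using True zs(3) by (simp add: of_nat_diff algebra_simps)
      then show "x \<in> lattice_cone n d z t"
        using zs(1,2) by (auto simp: lattice_cone_def dilated_simplex_def x \<phi>_def)
    qed
    show "\<psi> ` lattice_cone n d z t \<subseteq> L"
    proof
      fix l assume "l \<in> \<psi> ` lattice_cone n d z t"
      then obtain x where x: "x \<in> lattice_cone n d z t" and l: "l = \<psi> x" by blast
      have len: "length l = Suc n" by (simp add: l \<psi>_def)
      have coord: "int d * int (l ! i) = x i - z i" if "i \<le> n" for i
        using x that d
        by (auto simp: lattice_cone_def l \<psi>_def pos_imp_zdiv_nonneg_iff simp del: upt_Suc)
      have "int d * int (sum_list l) = (\<Sum>i\<le>n. int d * int (l ! i))"
        using len by (simp add: sum_list_sum_nth atLeast0LessThan lessThan_Suc_atMost sum_distrib_left)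
      also have "\<dots> = (\<Sum>i\<le>n. x i) - (\<Sum>i\<le>n. z i)"
        using coord by (simp add: sum_subtractf)
      also have "\<dots> = int d * int (t - D)"
        using x True zs(3) by (simp add: lattice_cone_def dilated_simplex_def of_nat_diff algebra_simps)
      finally have "sum_list l = t - D" using d by simp
      with len show "l \<in> L" by (simp add: L_def)
    qed
  qed
  then have "card (lattice_cone n d z t) = card L"
    by (simp add: bij_betw_same_card)
  also have "\<dots> = (t - D + Suc n - 1) choose (t - D)"
    unfolding L_def by (rule card_length_sum_list)
  also have "\<dots> = (t - D + n) choose n"
    using binomial_symmetric[of "t - D" "t - D + n"] by simp
  finally show ?thesis using True by simp
qed

lemma finite_dilated_simplex: "finite (dilated_simplex n d t)"
proof -
  have "x i \<le> int (d * t)" if "x \<in> dilated_simplex n d t" for x i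
    using that member_le_sum[of i "{..n}" x] by (cases "i \<le> n") (auto simp: dilated_simplex_def)
  then have "dilated_simplex n d t \<subseteq>
      {x. \<forall>i. (i \<in> {..n} \<longrightarrow> x i \<in> {0..int (d * t)}) \<and> (i \<notin> {..n} \<longrightarrow> x i = 0)}"
    by (auto simp: dilated_simplex_def)
  then show ?thesis
    by (rule finite_subset) (intro finite_set_of_finite_funs; simp)
qed

lemma finite_lattice_cone: "finite (lattice_cone n d z t)"
  using finite_dilated_simplex by (simp add: lattice_cone_def)

text \<open>
  The polynomial \<open>(t - D + n) gchoose n\<close> also counts the empty levels \<open>D - n \<le> t < D\<close>, since it
  vanishes there. This is where the phase transition gains \<open>n\<close> over the level of the apex.
\<close>

lemma polynomial_from_card_lattice_cone:
  assumes d: "d \<ge> 1" and z: "z \<in> dilated_simplex n d D" and D: "D \<le> T + n"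
  shows "polynomial_from T (\<lambda>t. of_nat (card (lattice_cone n d z t)))"
proof -
  define p :: "rat poly" where
    "p = smult (1 / fact n) (\<Prod>i = 0..<n. [:of_nat n - of_nat D - of_nat i, 1:])"
  have p: "poly p (of_nat t) = (of_nat t - of_nat D + of_nat n) gchoose n" for t
    by (simp add: p_def gbinomial_prod_rev poly_prod algebra_simps)
  have "of_nat (card (lattice_cone n d z t)) = poly p (of_nat t)" if "t \<ge> T" for t
  proof -
    have "(of_nat t - of_nat D + of_nat n :: rat) = of_nat (t + n - D)"
      using that D by (simp add: of_nat_diff)
    then have "poly p (of_nat t) = of_nat ((t + n - D) choose n)"
      by (simp add: p binomial_gbinomial)
    moreover have "t + n - D < n" if "\<not> D \<le> t"
      using that \<open>t \<ge> T\<close> D by linarith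
    ultimately show ?thesis
      by (auto simp: card_lattice_cone[OF d z] binomial_eq_0)
  qed
  then show ?thesis unfolding polynomial_from_def by blast
qed



lemma lattice_cone_Int:
  "lattice_cone n d z t \<inter> lattice_cone n d w t =
     (if \<forall>i. int d dvd z i - w i then lattice_cone n d (\<lambda>i. max (z i) (w i)) t else {})"
proof (cases "\<forall>i. int d dvd z i - w i")
  case True
  then have w_iff: "int d dvd x i - w i \<longleftrightarrow> int d dvd x i - z i" for x :: "nat \<Rightarrow> int" and i
    using dvd_add_right_iff[of "int d" "z i - w i" "x i - z i"] by simp
  then have "int d dvd x i - max (z i) (w i) \<longleftrightarrow> int d dvd x i - z i" for x :: "nat \<Rightarrow> int" and i
    by (simp add: max_def)
  with True w_iff show ?thesis
    by (auto simp: lattice_cone_def)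
next
  case False
  have "int d dvd z i - w i" if "int d dvd x i - z i" "int d dvd x i - w i" for x :: "nat \<Rightarrow> int" and i
    using dvd_diff[OF that(2,1)] by simp
  with False show ?thesis
    by (auto simp: lattice_cone_def)
qed

lemma dilated_simplex_add:
  "x \<in> dilated_simplex n d s \<Longrightarrow> y \<in> dilated_simplex n d t \<Longrightarrow> x + y \<in> dilated_simplex n d (s + t)"
  by (simp add: dilated_simplex_def sum.distrib algebra_simps)

lemma dilated_simplex_0: "dilated_simplex n d 0 = {0}"
proof (intro equalityI subsetI)
  fix x assume x: "x \<in> dilated_simplex n d 0"
  have "x i = 0" for i
    using x sum_nonneg_eq_0_iff[of "{..n}" x] by (cases "i \<le> n") (auto simp: dilated_simplex_def)
  then show "x \<in> {0}" by (auto simp: fun_eq_iff)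
qed (simp add: dilated_simplex_def)

lemma nfold_sumset_subset_dilated_simplex:
  assumes "B \<subseteq> dilated_simplex n d 1"
  shows "nfold_sumset t B \<subseteq> dilated_simplex n d t"
proof (induction t)
  case 0
  show ?case by (simp add: nfold_sumset_0 dilated_simplex_0)
next
  case (Suc t)
  with assms show ?case
    using dilated_simplex_add[of _ n d 1 _ t]
    by (auto simp: nfold_sumset_Suc elim!: set_plus_elim)
qed

abbreviation vertices :: "nat \<Rightarrow> nat \<Rightarrow> (nat \<Rightarrow> int) set" where
  "vertices n d \<equiv> axis_vector d ` {..n}"

lemma vertices_subset_dilated_simplex: "vertices n d \<subseteq> dilated_simplex n d 1"
  by (auto simp: dilated_simplex_def axis_vector_def)

text \<open>
  The sums of \<open>k\<close> vertices are exactly the points of \<open>d \<nat>\<^sup>n\<^sup>+\<^sup>1\<close> at level \<open>k\<close>: a positive coordinate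
  of such a point is at least \<open>d\<close>, so that a vertex can be split off.
\<close>

lemma nfold_vertices:
  assumes d: "d \<ge> 1"
  shows "nfold_sumset k (vertices n d) = {y \<in> dilated_simplex n d k. \<forall>i. int d dvd y i}"
proof (intro equalityI subsetI)
  fix y assume y: "y \<in> nfold_sumset k (vertices n d)"
  have "\<forall>i. int d dvd y i"
    using y
  proof (induction k arbitrary: y)
    case (Suc k)
    then show ?case
      by (force simp: nfold_sumset_Suc axis_vector_def elim!: set_plus_elim)
  qed (auto simp: nfold_sumset_0 zero_fun_def)
  then show "y \<in> {y \<in> dilated_simplex n d k. \<forall>i. int d dvd y i}"
    using y nfold_sumset_subset_dilated_simplex[OF vertices_subset_dilated_simplex] by blast
next
  fix y assume "y \<in> {y \<in> dilated_simplex n d k. \<forall>i. int d dvd y i}"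
  then have "y \<in> dilated_simplex n d k" "\<forall>i. int d dvd y i" by auto
  then show "y \<in> nfold_sumset k (vertices n d)"
  proof (induction k arbitrary: y)
    case 0
    then show ?case by (simp only: nfold_sumset_0 dilated_simplex_0)
  next
    case (Suc k)
    have y: "\<And>i. 0 \<le> y i" "\<And>i. i > n \<Longrightarrow> y i = 0" "(\<Sum>i\<le>n. y i) = int (d * Suc k)"
      using Suc.prems by (auto simp: dilated_simplex_def)
    have "\<exists>i\<le>n. y i > 0"
    proof (rule ccontr)
      assume "\<not> ?thesis"
      then have "(\<Sum>i\<le>n. y i) \<le> 0" by (intro sum_nonpos) auto
      moreover have "int (d * Suc k) > 0" using d by (simp only: of_nat_0_less_iff) simp
      ultimately show False using y(3) by linarith
    qed
    then obtain i where i: "i \<le> n" "y i > 0" by blast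
    then have di: "int d \<le> y i" using Suc.prems(2) zdvd_imp_le by blast
    define y' where "y' = y - axis_vector d i"
    have "(\<Sum>j\<le>n. y' j) = int (d * k)"
      using y(3) i by (simp add: y'_def sum_subtractf axis_vector_def algebra_simps)
    then have "y' \<in> dilated_simplex n d k"
      using y(1,2) i di by (auto simp: y'_def dilated_simplex_def axis_vector_def)
    moreover have "\<forall>i. int d dvd y' i"
      using Suc.prems(2) by (simp add: y'_def axis_vector_def)
    ultimately have "y' \<in> nfold_sumset k (vertices n d)"
      by (rule Suc.IH)
    moreover have "y = axis_vector d i + y'"
      by (simp add: y'_def)
    ultimately show ?case
      unfolding nfold_sumset_Suc using i(1) by (metis set_plus_intro imageI atMost_iff)
  qed
qed

section \<open>The reduction number\<close>

locale simplex_generators =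
  fixes n d :: nat and B :: "(nat \<Rightarrow> int) set"
  assumes d: "d \<ge> 1"
    and finite_B: "finite B"
    and B_subset: "B \<subseteq> dilated_simplex n d 1"
    and vertices_subset: "vertices n d \<subseteq> B"
begin

lemma vertices_plus_subset: "vertices n d + nfold_sumset t B \<subseteq> nfold_sumset (Suc t) B"
  unfolding nfold_sumset_Suc by (rule set_plus_mono2) (use vertices_subset in auto)

lemma nfold_generator:
  assumes "a \<in> B"
  shows "(\<Sum>i\<in>I. a) \<in> dilated_simplex n d (card I)"
    and "card I = d \<Longrightarrow> (\<Sum>i\<in>I. a) \<in> nfold_sumset d (vertices n d)"
proof -
  have eq: "(\<Sum>i\<in>I. a) = (\<lambda>j. int (card I) * a j)"
    by (induction I rule: infinite_finite_induct) (auto simp: fun_eq_iff algebra_simps)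
  have "a \<in> dilated_simplex n d 1" using assms B_subset by blast
  then show *: "(\<Sum>i\<in>I. a) \<in> dilated_simplex n d (card I)"
    unfolding eq by (simp add: dilated_simplex_def flip: sum_distrib_left)
  assume "card I = d"
  with * show "(\<Sum>i\<in>I. a) \<in> nfold_sumset d (vertices n d)"
    by (simp add: nfold_vertices[OF d] eq)
qed

text \<open>
  The reduction number is a genuine minimum. A sum of more than \<open>d |B|\<close> elements of \<open>B\<close> repeats some
  \<open>a\<close> at least \<open>d\<close> times, and \<open>d a\<close> is a sum of \<open>d\<close> vertices because its coordinates are divisible
  by \<open>d\<close>. Hence the sum can be rewritten as one that contains a vertex.
\<close>

lemma ex_reduction:
  "\<exists>r>0. nfold_sumset (r + 1) B = vertices n d + nfold_sumset r B"
proof (intro exI conjI)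
  let ?r = "card B * d"
  have B0: "B \<noteq> {}" using vertices_subset by auto
  then show "?r > 0" using d finite_B by (simp add: card_gt_0_iff)
  show "nfold_sumset (?r + 1) B = vertices n d + nfold_sumset ?r B"
  proof (intro equalityI subsetI)
    fix x assume "x \<in> nfold_sumset (?r + 1) B"
    then obtain b where x: "x = (\<Sum>i<?r + 1. b i)" and b: "\<And>i. i < ?r + 1 \<Longrightarrow> b i \<in> B"
      by (auto simp: nfold_sumset_def)
    have "b \<in> {..<?r + 1} \<rightarrow> B" using b by auto
    from pigeonhole_card[OF this finite_lessThan finite_B B0]
    obtain a where a: "a \<in> B" and "card (b -` {a} \<inter> {..<?r + 1}) * card B \<ge> ?r + 1"
      by auto
    then have "d * card B < card (b -` {a} \<inter> {..<?r + 1}) * card B"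
      by (subst mult.commute) linarith
    then have "d \<le> card (b -` {a} \<inter> {..<?r + 1})"
      by simp
    then obtain I where I: "I \<subseteq> b -` {a} \<inter> {..<?r + 1}" "card I = d"
      by (meson obtain_subset_with_card_n)
    let ?J = "{..<?r + 1} - I"
    have finI: "finite I" using I(1) finite_subset by blast
    have cJ: "card ?J = ?r + 1 - d" using I finI by (subst card_Diff_subset) auto
    \<comment> \<open>Needed for the truncated subtraction in \<open>?r + 1 - d\<close>.\<close>
    have dr: "d \<le> ?r" using d \<open>?r > 0\<close> by (cases "card B") auto
    have "sum b I = (\<Sum>i\<in>I. a)"
      using I(1) by (intro sum.cong) auto
    then have "sum b I \<in> nfold_sumset (Suc (d - 1)) (vertices n d)"
      using nfold_generator(2)[OF a I(2)] d by simp
    then obtain e y where e: "e \<in> vertices n d" and y: "y \<in> nfold_sumset (d - 1) (vertices n d)"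
      and ey: "sum b I = e + y"
      unfolding nfold_sumset_Suc by (rule set_plus_elim)
    have "y \<in> nfold_sumset (d - 1) B"
      using y nfold_sumset_mono[OF vertices_subset] by blast
    moreover have "sum b ?J \<in> nfold_sumset (?r + 1 - d) B"
      using sum_in_nfold_sumset[of ?J b B] b cJ by auto
    ultimately have "y + sum b ?J \<in> nfold_sumset (d - 1 + (?r + 1 - d)) B"
      unfolding nfold_sumset_add[symmetric] by (rule set_plus_intro)
    also have "d - 1 + (?r + 1 - d) = ?r" using d dr by linarith
    finally have "e + (y + sum b ?J) \<in> vertices n d + nfold_sumset ?r B"
      using e by blast
    moreover have "x = sum b I + sum b ?J"
      unfolding x using I(1) by (subst add.commute, intro sum.subset_diff) auto
    ultimately show "x \<in> vertices n d + nfold_sumset ?r B"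
      by (simp add: ey add.assoc)
  qed (use vertices_plus_subset[of ?r] in auto)
qed

text \<open>
  An element of \<open>B\<close> has coordinate sum \<open>d\<close>, so a coordinate that reaches \<open>d\<close> forces all others to
  vanish and makes the element a vertex.
\<close>

lemma non_vertex_coord_le:
  assumes "b \<in> nfold_sumset j (B - vertices n d)"
  shows "b i \<le> int j * (int d - 1)"
  using assms
proof (induction j arbitrary: b)
  case 0
  then show ?case by (simp add: nfold_sumset_0)
next
  case (Suc j)
  then obtain a c where a: "a \<in> B" "a \<notin> vertices n d" and c: "c \<in> nfold_sumset j (B - vertices n d)"
    and b: "b = a + c"
    by (auto simp: nfold_sumset_Suc elim!: set_plus_elim)
  have "a i < int d"
  proof (rule ccontr)
    assume ai: "\<not> a i < int d"
    have a': "\<And>i. 0 \<le> a i" "\<And>i. i > n \<Longrightarrow> a i = 0" "(\<Sum>i\<le>n. a i) = int d"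
      using a(1) B_subset by (auto simp: dilated_simplex_def)
    have i: "i \<le> n" using ai a'(2)[of i] d by (cases "i \<le> n") auto
    then have sum: "(\<Sum>i\<le>n. a i) = a i + (\<Sum>k\<in>{..n} - {i}. a k)"
      by (simp add: sum.remove)
    moreover have "(\<Sum>k\<in>{..n} - {i}. a k) \<ge> 0" using a'(1) by (simp add: sum_nonneg)
    ultimately have "a i = int d" "(\<Sum>k\<in>{..n} - {i}. a k) = 0" using ai a'(3) by auto
    then have "a k = 0" if "k \<noteq> i" for k
      using that a'(1,2) sum_nonneg_eq_0_iff[of "{..n} - {i}" a] by (cases "k \<le> n") auto
    with \<open>a i = int d\<close> have "a = axis_vector d i" by (auto simp: axis_vector_def)
    with a(2) i show False by blast
  qed
  with Suc.IH[OF c] show ?case by (simp add: b algebra_simps)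
qed

end

locale simplex_reduction = simplex_generators +
  fixes r :: nat
  assumes r: "r > 0"
    and reduction: "nfold_sumset (r + 1) B = vertices n d + nfold_sumset r B"
begin

lemma reduction_persists:
  assumes "t \<ge> r"
  shows "nfold_sumset (Suc t) B = vertices n d + nfold_sumset t B"
  using assms
proof (induction t rule: dec_induct)
  case base
  show ?case using reduction by simp
next
  case (step t)
  then show ?case
    by (metis nfold_sumset_Suc add.left_commute)
qed

text \<open>
  Sums of at most \<open>r\<close> non-vertices. This set generates the semigroup of \<open>B\<close> over the vertices, in
  general not minimally; it is used instead of a minimal generating set because the bounds on
  coordinates can be read off from it.
\<close>

definition module_generators :: "(nat \<Rightarrow> int) set" where
  "module_generators = (\<Union>j\<le>r. nfold_sumset j (B - vertices n d))"

text \<open>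
  Induction on \<open>t\<close>. The summand added in step \<open>t + 1\<close> may be a non-vertex while \<open>t < r\<close>; from \<open>t = r\<close>
  on it can be chosen to be a vertex, so the number of non-vertices stays at most \<open>r\<close>.
\<close>

lemma nfold_sumset_decomposition:
  "nfold_sumset t B \<subseteq>
     (\<Union>j\<in>{..min t r}. nfold_sumset j (B - vertices n d) + nfold_sumset (t - j) (vertices n d))"
proof (induction t)
  case 0
  show ?case by (simp add: nfold_sumset_0)
next
  case (Suc t)
  show ?case
  proof
    fix x assume x: "x \<in> nfold_sumset (Suc t) B"
    have "\<exists>a y. x = a + y \<and> y \<in> nfold_sumset t B \<and> (a \<in> vertices n d \<or> a \<in> B - vertices n d \<and> t < r)"
    proof (cases "t < r")
      case True
      then show ?thesis using x by (auto simp: nfold_sumset_Suc elim!: set_plus_elim)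
    next
      case False
      then show ?thesis using x reduction_persists[of t] by (auto elim!: set_plus_elim)
    qed
    then obtain a y where ay: "x = a + y" "y \<in> nfold_sumset t B"
      and a: "a \<in> vertices n d \<or> a \<in> B - vertices n d \<and> t < r"
      by blast
    then obtain j b e where j: "j \<le> t" "j \<le> r"
      and be: "b \<in> nfold_sumset j (B - vertices n d)" "e \<in> nfold_sumset (t - j) (vertices n d)"
      and y: "y = b + e"
      using Suc.IH by (fastforce elim!: set_plus_elim)
    from a show "x \<in> (\<Union>j\<in>{..min (Suc t) r}.
        nfold_sumset j (B - vertices n d) + nfold_sumset (Suc t - j) (vertices n d))"
    proof
      assume "a \<in> vertices n d"
      then have "a + e \<in> nfold_sumset (Suc t - j) (vertices n d)"
        using be(2) j by (auto simp: Suc_diff_le nfold_sumset_Suc)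
      then have "b + (a + e) \<in> nfold_sumset j (B - vertices n d) + nfold_sumset (Suc t - j) (vertices n d)"
        using be(1) by blast
      moreover have "x = b + (a + e)" by (simp add: ay y add.left_commute)
      ultimately show ?thesis using j by auto
    next
      assume a: "a \<in> B - vertices n d \<and> t < r"
      then have "a + b \<in> nfold_sumset (Suc j) (B - vertices n d)"
        using be(1) by (auto simp: nfold_sumset_Suc)
      then have "(a + b) + e \<in> nfold_sumset (Suc j) (B - vertices n d)
          + nfold_sumset (Suc t - Suc j) (vertices n d)"
        using be(2) by auto
      moreover have "x = (a + b) + e" by (simp add: ay y add.assoc)
      ultimately show ?thesis using j a by (intro UN_I[of "Suc j"]) auto
    qed
  qed
qed

lemma nfold_sumset_eq_Union_cones:
  "nfold_sumset t B = (\<Union>b\<in>module_generators. lattice_cone n d b t)"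
proof (intro equalityI subsetI)
  fix x assume x: "x \<in> nfold_sumset t B"
  then obtain j b e where j: "j \<le> t" "j \<le> r"
    and b: "b \<in> nfold_sumset j (B - vertices n d)"
    and e: "e \<in> nfold_sumset (t - j) (vertices n d)"
    and xe: "x = b + e"
    using nfold_sumset_decomposition by (fastforce elim!: set_plus_elim)
  have "b \<in> module_generators" using b j by (auto simp: module_generators_def)
  moreover have "x \<in> lattice_cone n d b t"
    using e x nfold_sumset_subset_dilated_simplex[OF B_subset]
    by (auto simp: lattice_cone_def nfold_vertices[OF d] xe) (simp add: dilated_simplex_def)
  ultimately show "x \<in> (\<Union>b\<in>module_generators. lattice_cone n d b t)" by blast
next
  fix x assume "x \<in> (\<Union>b\<in>module_generators. lattice_cone n d b t)"
  then obtain j b where b: "b \<in> nfold_sumset j (B - vertices n d)"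
    and x: "x \<in> lattice_cone n d b t"
    by (auto simp: module_generators_def)
  have bB: "b \<in> nfold_sumset j B"
    using b nfold_sumset_mono[of "B - vertices n d" B] by blast
  then have bs: "b \<in> dilated_simplex n d j"
    using nfold_sumset_subset_dilated_simplex[OF B_subset] by blast
  have "j \<le> t"
    by (rule lattice_cone_level_le[OF d bs x])
  have "x - b \<in> dilated_simplex n d (t - j)"
    using x bs \<open>j \<le> t\<close>
    by (auto simp: lattice_cone_def dilated_simplex_def sum_subtractf of_nat_diff algebra_simps)
  then have "x - b \<in> nfold_sumset (t - j) (vertices n d)"
    using x by (simp add: nfold_vertices[OF d] lattice_cone_def)
  then have "x - b \<in> nfold_sumset (t - j) B"
    using nfold_sumset_mono[OF vertices_subset] by blast
  with bB have "b + (x - b) \<in> nfold_sumset (j + (t - j)) B"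
    unfolding nfold_sumset_add[symmetric] by (rule set_plus_intro)
  then show "x \<in> nfold_sumset t B" using \<open>j \<le> t\<close> by simp
qed


text \<open>
  Every coordinate is borrowed from a generator in the same class modulo \<open>d\<close>. The coordinatewise
  maxima of congruent generators, i.e. the least common multiples of the corresponding monomials,
  have this form. The larger set is used because it is visibly closed under maxima and each of its
  coordinates can be estimated from a single generator.
\<close>

definition corners :: "(nat \<Rightarrow> int) set" where
  "corners = {z. \<forall>i. \<exists>b\<in>module_generators. (\<forall>j. int d dvd z j - b j) \<and> z i = b i}"

lemma module_generators_subset_corners: "module_generators \<subseteq> corners"
proof
  fix b assume "b \<in> module_generators"
  then show "b \<in> corners"
    unfolding corners_def by (intro CollectI allI bexI[of _ b]) auto
qed

lemma corners_max:
  assumes z: "z \<in> corners" and w: "w \<in> corners" and zw: "\<forall>i. int d dvd z i - w i"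
  shows "(\<lambda>i. max (z i) (w i)) \<in> corners"
proof -
  have max_cong: "int d dvd max (z j) (w j) - x \<longleftrightarrow> int d dvd z j - x"
    "int d dvd z j - x \<longleftrightarrow> int d dvd w j - x" for j x
  proof -
    show "int d dvd z j - x \<longleftrightarrow> int d dvd w j - x"
      using dvd_add_right_iff[of "int d" "z j - w j" "w j - x"] zw by simp
    then show "int d dvd max (z j) (w j) - x \<longleftrightarrow> int d dvd z j - x"
      by (simp add: max_def)
  qed
  show ?thesis unfolding corners_def
  proof (intro CollectI allI)
    fix i
    show "\<exists>b\<in>module_generators. (\<forall>j. int d dvd max (z j) (w j) - b j) \<and> max (z i) (w i) = b i"
    proof (cases "w i \<le> z i")
      case True
      with z show ?thesis unfolding corners_def max_cong(1) by (simp add: max_def)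
    next
      case False
      with w show ?thesis unfolding corners_def max_cong by (simp add: max_def)
    qed
  qed
qed

lemma module_generatorsD:
  assumes "b \<in> module_generators"
  obtains j where "j \<le> r" "b \<in> dilated_simplex n d j" "\<And>i. b i \<le> int r * (int d - 1)"
proof -
  obtain j where j: "j \<le> r" and b: "b \<in> nfold_sumset j (B - vertices n d)"
    using assms by (auto simp: module_generators_def)
  have "b \<in> dilated_simplex n d j"
    using b nfold_sumset_subset_dilated_simplex[of "B - vertices n d" n d] B_subset by blast
  moreover have "b i \<le> int r * (int d - 1)" for i
  proof -
    have "b i \<le> int j * (int d - 1)" using b by (rule non_vertex_coord_le)
    also have "\<dots> \<le> int r * (int d - 1)" using j d by (intro mult_right_mono) auto
    finally show ?thesis .
  qed
  ultimately show thesis using that j by blast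
qed

lemma finite_module_generators: "finite module_generators"
  using finite_B by (auto simp: module_generators_def intro: finite_nfold_sumset)

lemma corner_level:
  assumes z: "z \<in> corners"
  obtains D where "z \<in> dilated_simplex n d D"
proof -
  have coord: "0 \<le> z i \<and> (i > n \<longrightarrow> z i = 0)" for i
  proof -
    obtain b where b: "b \<in> module_generators" "z i = b i"
      using z unfolding corners_def by blast
    obtain j where "b \<in> dilated_simplex n d j" using b(1) by (rule module_generatorsD)
    with b(2) show ?thesis by (simp add: dilated_simplex_def)
  qed
  then have nonneg: "0 \<le> z i" and support: "i > n \<Longrightarrow> z i = 0" for i by auto
  obtain b where b: "b \<in> module_generators" "\<forall>j. int d dvd z j - b j"
    using z unfolding corners_def by blast
  obtain j where j: "b \<in> dilated_simplex n d j" using b(1) by (rule module_generatorsD)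
  have "int d dvd (\<Sum>i\<le>n. z i - b i)" using b(2) by (intro dvd_sum) auto
  moreover have "int d dvd (\<Sum>i\<le>n. b i)" using j by (simp add: dilated_simplex_def)
  ultimately have "int d dvd (\<Sum>i\<le>n. z i)"
    by (simp add: sum_subtractf dvd_diff_left_iff)
  then obtain k where k: "(\<Sum>i\<le>n. z i) = int d * k" by (rule dvdE)
  have "(\<Sum>i\<le>n. z i) \<ge> 0" using nonneg by (simp add: sum_nonneg)
  then have "k \<ge> 0" using k d by (simp add: zero_le_mult_iff)
  then have "z \<in> dilated_simplex n d (nat k)"
    using nonneg support k by (simp add: dilated_simplex_def)
  then show thesis by (rule that)
qed

lemma corner_level_le_coord:
  assumes z: "z \<in> corners" "z \<in> dilated_simplex n d D"
  shows "int d * int D \<le> (int n + 1) * int r * (int d - 1)"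
proof -
  have coord: "z i \<le> int r * (int d - 1)" for i
  proof -
    obtain b where b: "b \<in> module_generators" "z i = b i"
      using z(1) unfolding corners_def by blast
    from b(1) show ?thesis by (rule module_generatorsD) (simp add: b(2))
  qed
  have "int d * int D = (\<Sum>i\<le>n. z i)" using z(2) by (simp add: dilated_simplex_def)
  also have "\<dots> \<le> (\<Sum>i\<le>n. int r * (int d - 1))"
    using coord by (intro sum_mono)
  finally show ?thesis by (simp add: algebra_simps)
qed

text \<open>
  Let \<open>q\<close> be the largest of the quotients \<open>z\<^sub>i div d\<close>, and let \<open>b\<close> be a generator that shares with \<open>z\<close>
  the coordinate \<open>i\<close> attaining it. Every coordinate of \<open>b\<close> is at least its residue, so
  \<open>d q\<close> plus the sum of all residues is at most the coordinate sum of \<open>b\<close>, hence at most \<open>d r\<close>.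
  This bounds the residues by \<open>d (r - q)\<close>; the quotients contribute at most \<open>(n + 1) q\<close>, so that
  \<open>D \<le> n q + r\<close>. Finally \<open>q \<le> r - 1\<close>, because \<open>b\<close> is a sum of non-vertices.
\<close>

lemma corner_level_le_residue:
  assumes z: "z \<in> corners" "z \<in> dilated_simplex n d D"
  shows "int D \<le> int n * (int r - 1) + int r"
proof -
  define q where "q = Max ((\<lambda>i. z i div int d) ` {..n})"
  have "q \<in> (\<lambda>i. z i div int d) ` {..n}"
    unfolding q_def by (rule Max_in) auto
  then obtain i where i: "i \<le> n" "q = z i div int d" by auto
  have q: "z k div int d \<le> q" if "k \<le> n" for k
    unfolding q_def using that by (intro Max_ge) auto
  obtain b where b: "b \<in> module_generators" "\<forall>k. int d dvd z k - b k" "z i = b i"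
    using z(1) unfolding corners_def by blast
  obtain j where j: "j \<le> r" "b \<in> dilated_simplex n d j" "b i \<le> int r * (int d - 1)"
    using b(1) by (rule module_generatorsD) blast
  have "int d * q \<le> z i"
    using d i(2) by (metis mult_div_mod_eq le_add_same_cancel1 pos_mod_sign of_nat_0_less_iff less_le_trans zero_less_one)
  also have "\<dots> < int d * int r"
    using j(3) b(3) r by (simp add: algebra_simps)
  finally have qr: "q \<le> int r - 1" using d by simp
  have mod_le: "z k mod int d \<le> b k" for k
  proof -
    have "z k mod int d = b k mod int d" using b(2) by (simp add: mod_eq_dvd_iff)
    also have "\<dots> \<le> b k" using j(2) by (intro zmod_le_nonneg_dividend) (simp add: dilated_simplex_def)
    finally show ?thesis .
  qed
  have "int d * q + (\<Sum>k\<le>n. z k mod int d) =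
      int d * q + z i mod int d + (\<Sum>k\<in>{..n} - {i}. z k mod int d)"
    using i(1) by (simp add: sum.remove)
  also have "\<dots> = b i + (\<Sum>k\<in>{..n} - {i}. z k mod int d)"
    using i(2) b(3) by simp
  also have "\<dots> \<le> b i + (\<Sum>k\<in>{..n} - {i}. b k)"
    using mod_le by (intro add_left_mono sum_mono) auto
  also have "\<dots> = int d * int j"
    using i(1) j(2) by (simp add: dilated_simplex_def flip: sum.remove)
  also have "\<dots> \<le> int d * int r" using j(1) by (intro mult_left_mono) auto
  finally have rest: "(\<Sum>k\<le>n. z k mod int d) \<le> int d * int r - int d * q" by simp
  have "int d * int D = (\<Sum>k\<le>n. z k)" using z(2) by (simp add: dilated_simplex_def)
  also have "\<dots> = (\<Sum>k\<le>n. int d * (z k div int d)) + (\<Sum>k\<le>n. z k mod int d)"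
    by (simp flip: sum.distrib)
  also have "\<dots> \<le> (\<Sum>k\<le>n. int d * q) + (int d * int r - int d * q)"
    using q rest by (intro add_mono sum_mono mult_left_mono) auto
  also have "\<dots> = int d * (int n * q + int r)" by (simp add: algebra_simps)
  finally have "int D \<le> int n * q + int r" using d by simp
  also have "\<dots> \<le> int n * (int r - 1) + int r"
    using qr by (intro add_mono mult_left_mono) auto
  finally show ?thesis .
qed

lemma polynomial_from_card_nfold_sumset:
  assumes "\<And>z D. z \<in> corners \<Longrightarrow> z \<in> dilated_simplex n d D \<Longrightarrow> D \<le> T + n"
  shows "polynomial_from T (\<lambda>t. of_nat (card (nfold_sumset t B)))"
proof -
  \<comment> \<open>The empty family is the intersection of two cones whose apexes are not congruent.\<close>
  let ?\<C> = "insert (\<lambda>t. {}) (lattice_cone n d ` corners)"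
  have poly: "polynomial_from T (\<lambda>t. of_nat (card (c t)))" if "c \<in> ?\<C>" for c
    using that
  proof
    assume "c \<in> lattice_cone n d ` corners"
    then obtain z where z: "z \<in> corners" "c = lattice_cone n d z" by blast
    obtain D where "z \<in> dilated_simplex n d D" using z(1) by (rule corner_level)
    then show ?thesis
      using z assms d by (auto intro: polynomial_from_card_lattice_cone)
  qed (simp add: polynomial_from_0)
  have fin: "finite (c t)" if "c \<in> ?\<C>" for c t
    using that
    by (auto simp: finite_lattice_cone)
  have closed: "(\<lambda>t. c t \<inter> c' t) \<in> ?\<C>" if "c \<in> ?\<C>" "c' \<in> ?\<C>" for c c'
  proof (cases "c = (\<lambda>t. {}) \<or> c' = (\<lambda>t. {})")
    case False
    then have "c \<in> lattice_cone n d ` corners" "c' \<in> lattice_cone n d ` corners"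
      using that by simp_all
    then obtain z w where "z \<in> corners" "w \<in> corners"
      "c = lattice_cone n d z" "c' = lattice_cone n d w"
      by (elim imageE)
    moreover have "(\<lambda>t. lattice_cone n d z t \<inter> lattice_cone n d w t) =
        (if \<forall>i. int d dvd z i - w i then lattice_cone n d (\<lambda>i. max (z i) (w i)) else (\<lambda>t. {}))"
      by (rule ext) (simp add: lattice_cone_Int)
    ultimately show ?thesis
      using corners_max[of z w] by simp
  qed auto
  have "polynomial_from T
      (\<lambda>t. of_nat (card (\<Union>c\<in>lattice_cone n d ` module_generators. c t)))"
    using finite_module_generators module_generators_subset_corners
    by (intro card_Union_polynomial_from[where \<C> = ?\<C>] closed fin poly) auto
  then show ?thesis by (simp add: nfold_sumset_eq_Union_cones)
qed

end

section \<open>The phase transition\<close>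

lemma total_degree_le_max_degree:
  assumes "finite A" and "a \<in> A"
  shows "total_degree n a \<le> int (max_degree n A)"
proof -
  have "total_degree n a \<le> int (nat (Max (total_degree n ` A)))" if "a \<in> A" for a
  proof -
    have "total_degree n a \<le> Max (total_degree n ` A)" using assms(1) that by simp
    then show ?thesis by linarith
  qed
  then have "\<forall>a\<in>A. total_degree n a \<le> int (nat (Max (total_degree n ` A)))" by blast
  then have "\<forall>a\<in>A. total_degree n a \<le> int (max_degree n A)"
    unfolding max_degree_def by (rule LeastI)
  then show ?thesis using assms(2) by blast
qed

text \<open>
  The vertices \<open>e\<^sub>1, \<dots>, e\<^sub>n\<close> come from the points \<open>v\<^sub>i\<close> of \<open>A\<close>, and \<open>e\<^sub>0\<close> from the origin.
\<close>

lemma simplex_generators_homogenization: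
  assumes "finite A" and "A \<subseteq> nonneg_vectors n" and "max_degree n A \<ge> 1"
    and "insert 0 (axis_vector (max_degree n A) ` {1..n}) \<subseteq> A"
  shows "simplex_generators n (max_degree n A) (homogenization n A)"
proof
  let ?d = "max_degree n A" and ?h = "\<lambda>a. a(0 := int (max_degree n A) - total_degree n a)"
  show "?d \<ge> 1" by fact
  show "finite (homogenization n A)" using assms(1) by (simp add: homogenization_def)
  have "?h a \<in> dilated_simplex n ?d 1" if "a \<in> A" for a
  proof -
    have "{..n} = insert 0 {1..n}" by auto
    then have "(\<Sum>i\<le>n. ?h a i) = ?h a 0 + (\<Sum>i=1..n. ?h a i)" by simp
    also have "(\<Sum>i=1..n. ?h a i) = total_degree n a"
      unfolding total_degree_def by (intro sum.cong) auto
    finally show ?thesis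
      using that assms(2) total_degree_le_max_degree[OF assms(1) that]
      by (auto simp: dilated_simplex_def nonneg_vectors_def)
  qed
  then show "homogenization n A \<subseteq> dilated_simplex n ?d 1"
    by (auto simp: homogenization_def)
  show "vertices n ?d \<subseteq> homogenization n A"
  proof
    fix v assume "v \<in> vertices n ?d"
    then obtain i where i: "i \<le> n" "v = axis_vector ?d i" by auto
    show "v \<in> homogenization n A"
    proof (cases "i = 0")
      case True
      have "v = ?h 0" by (auto simp: i(2) True axis_vector_def total_degree_def)
      then show ?thesis using assms(4) by (auto simp: homogenization_def)
    next
      case False
      then have "total_degree n v = int ?d"
        using i by (simp add: total_degree_def axis_vector_def)
      then have "v = ?h v" using False by (auto simp: i(2) axis_vector_def)
      moreover have "v \<in> A" using assms(4) i False by auto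
      ultimately show ?thesis unfolding homogenization_def by blast
    qed
  qed
qed

text \<open>
  Setting coordinate \<open>0\<close> to zero is additive and inverts the homogenization. It is injective on
  each Minkowski power, where the fixed coordinate sum determines coordinate \<open>0\<close>.
\<close>

lemma card_nfold_sumset_homogenization:
  assumes "A \<subseteq> nonneg_vectors n"
    and "homogenization n A \<subseteq> dilated_simplex n d 1"
  shows "card (nfold_sumset t (homogenization n A)) = card (nfold_sumset t A)"
proof -
  let ?\<pi> = "\<lambda>x :: nat \<Rightarrow> int. x(0 := 0)"
  have "?\<pi> (a(0 := c)) = a" if "a \<in> A" for a c
  proof -
    have "a \<in> nonneg_vectors n" using that assms(1) by blast
    then have "a 0 = 0" by (simp add: nonneg_vectors_def)
    then show ?thesis by (simp add: fun_upd_idem)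
  qed
  then have "?\<pi> ` homogenization n A = A"
    by (simp add: homogenization_def image_image)
  moreover have "?\<pi> ` nfold_sumset t (homogenization n A) = nfold_sumset t (?\<pi> ` homogenization n A)"
    by (rule nfold_sumset_image[symmetric]) (auto simp: fun_eq_iff)
  moreover have "inj_on ?\<pi> (nfold_sumset t (homogenization n A))"
  proof (rule inj_onI)
    fix x y assume xy: "x \<in> nfold_sumset t (homogenization n A)"
      "y \<in> nfold_sumset t (homogenization n A)" and eq: "?\<pi> x = ?\<pi> y"
    have eq': "x i = y i" if "i \<noteq> 0" for i
      using fun_cong[OF eq, of i] that by simp
    have "(\<Sum>i\<le>n. x i) = (\<Sum>i\<le>n. y i)"
      using xy nfold_sumset_subset_dilated_simplex[OF assms(2), of t]
      by (auto simp: dilated_simplex_def subset_iff)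
    moreover have "(\<Sum>i\<in>{..n} - {0}. x i) = (\<Sum>i\<in>{..n} - {0}. y i)"
      using eq' by (intro sum.cong) auto
    ultimately have "x 0 = y 0"
      using sum.remove[of "{..n}" 0 x] sum.remove[of "{..n}" 0 y] by simp
    show "x = y"
    proof
      fix i show "x i = y i"
        using eq'[of i] \<open>x 0 = y 0\<close> by (cases "i = 0") auto
    qed
  qed
  ultimately show ?thesis by (metis card_image)
qed

theorem theorem4p11:
  fixes n :: nat and A :: "(nat \<Rightarrow> int) set"
  assumes "n \<ge> 1"
    and "finite A"
    and "A \<subseteq> nonneg_vectors n"
    and "max_degree n A \<ge> 1"
    and "insert 0 (axis_vector (max_degree n A) ` {1..n}) \<subseteq> A"
  shows "(reduction_number n A \<le> 1 \<longrightarrow> phase_transition A \<le> 2) \<and>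
    (reduction_number n A > 1 \<longrightarrow>
      int (phase_transition A) \<le>
        min ((int n + 1) * (int (reduction_number n A) - 1) - int n + 2)
            ((int n + 1) * int (reduction_number n A)
              - \<lceil>real ((n + 1) * reduction_number n A) / real (max_degree n A)\<rceil> + 1))"
proof -
  define d where "d = max_degree n A"
  define r where "r = reduction_number n A"
  define B where "B = homogenization n A"
  interpret simplex_generators n d B
    unfolding d_def B_def by (rule simplex_generators_homogenization) (use assms in auto)
  have r: "0 < r \<and> nfold_sumset (r + 1) B = vertices n d + nfold_sumset r B"
    unfolding r_def reduction_number_def d_def[symmetric] B_def[symmetric] atLeast0AtMost
    by (rule LeastI_ex) (rule ex_reduction)
  then interpret simplex_reduction n d B r
    by unfold_locales auto
  have phase: "int (phase_transition A) \<le> T"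
    if "T \<ge> 0" and le: "\<And>z D. z \<in> corners \<Longrightarrow> z \<in> dilated_simplex n d D \<Longrightarrow> int D \<le> T + int n" for T
  proof -
    have "polynomial_from (nat T) (\<lambda>t. of_nat (card (nfold_sumset t B)))"
      using le \<open>T \<ge> 0\<close> by (intro polynomial_from_card_nfold_sumset) force
    then have "polynomial_from (nat T) (\<lambda>t. of_nat (card (nfold_sumset t A)))"
      using card_nfold_sumset_homogenization[OF assms(3)] B_subset by (simp add: B_def)
    then have "phase_transition A \<le> nat T" by (rule phase_transition_le)
    with \<open>T \<ge> 0\<close> show ?thesis by simp
  qed
  have "int (phase_transition A) \<le> 2" if "r \<le> 1"
  proof (rule phase)
    fix z D assume "z \<in> corners" "z \<in> dilated_simplex n d D"
    then have "int D \<le> int n * (int r - 1) + int r" by (rule corner_level_le_residue)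
    moreover have "r = 1" using r that by simp
    ultimately show "int D \<le> 2 + int n" by simp
  qed simp
  moreover have "int (phase_transition A) \<le> (int n + 1) * (int r - 1) - int n + 2" if "r > 1"
  proof (rule phase)
    have "0 \<le> (int n + 1) * (int r - 2) + 3" using that by simp
    then show "0 \<le> (int n + 1) * (int r - 1) - int n + 2" by (simp add: algebra_simps)
    fix z D assume "z \<in> corners" "z \<in> dilated_simplex n d D"
    then have "int D \<le> int n * (int r - 1) + int r" by (rule corner_level_le_residue)
    then show "int D \<le> (int n + 1) * (int r - 1) - int n + 2 + int n"
      by (simp add: algebra_simps)
  qed
  moreover have "int (phase_transition A) \<le>
      (int n + 1) * int r - \<lceil>real ((n + 1) * r) / real d\<rceil> + 1"
  proof (rule phase)
    have "real ((n + 1) * r) / real d \<le> real ((n + 1) * r) / 1"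
      using d by (intro divide_left_mono) auto
    then have "real ((n + 1) * r) / real d \<le> real ((n + 1) * r)" by (simp only: div_by_1)
    then have "\<lceil>real ((n + 1) * r) / real d\<rceil> \<le> int ((n + 1) * r)"
      by (simp add: ceiling_le_iff)
    then show "0 \<le> (int n + 1) * int r - \<lceil>real ((n + 1) * r) / real d\<rceil> + 1"
      by (simp add: algebra_simps)
    fix z D assume "z \<in> corners" "z \<in> dilated_simplex n d D"
    then have "int d * int D \<le> (int n + 1) * int r * (int d - 1)" by (rule corner_level_le_coord)
    then have "int ((n + 1) * r) \<le> (int ((n + 1) * r) - int D) * int d"
      by (simp add: algebra_simps)
    then have "real_of_int (int ((n + 1) * r)) \<le> real_of_int ((int ((n + 1) * r) - int D) * int d)"
      by (rule of_int_le_iff[THEN iffD2])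
    then have "real ((n + 1) * r) / real d \<le> real_of_int (int ((n + 1) * r) - int D)"
      using d by (simp add: divide_le_eq)
    then have "\<lceil>real ((n + 1) * r) / real d\<rceil> \<le> int ((n + 1) * r) - int D"
      by (simp only: ceiling_le_iff)
    then show "int D \<le> (int n + 1) * int r - \<lceil>real ((n + 1) * r) / real d\<rceil> + 1 + int n"
      by (simp add: algebra_simps)
  qed
  ultimately show ?thesis by (auto simp: r_def d_def)
qed

end
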